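(* Suppose the problem $\min_{x\in X}F(x)$, $F=f_1+f_2$, satisfies the local error bound property. Let $\{x^r\}_{r\ge 0}$ be a sequence generated by an approximate proximal splitting (APS) method for this problem, with some constant $\kappa>0$ and some stepsizes $\alpha^r$, and suppose that the sufficient decrease condition holds: there is a constant $c_1>0$ such that $F(x^r)\ge F(x^{r+1})+c_1\|x^{r+1}-x^r\|^2$ for all $r\ge 0$. Then $\{x^r\}$ converges R-linearly to an optimal solution of $\min_{x\in X}F(x)$; that is, there exist an optimal solution $x^\infty$ and constants $C\ge 0$, $q\in(0,1)$ such that $\|x^r-x^\infty\|\le Cq^r$ for all sufficiently large $r$.
   Context: Setting: $X\subseteq\mathbb{R}^n$ is a nonempty closed convex set, $f_1:\mathbb{R}^n\to(-\infty,+\infty]$ is a proper closed convex function (possibly non-smooth) that is finite at some point of $X$, and $f_2:\mathbb{R}^n\to\mathbb{R}$ is convex and differentiable with Lipschitz continuous gradient (constant $L$). $\|\cdot\|$ is the Euclidean norm. $X^*$ is the set of minimizers of $F=f_1+f_2$ over $X$, assumed nonempty, and $\bar X^*$ is its closure. Proximity operator: for a convex function $\varphi$, $\mathrm{prox}_{\varphi}(x)=\arg\min_{y\in X}\{\varphi(y)+\frac12\|y-x\|^2\}$ (the minimization is over the constraint set $X$). Residual and distance: $\psi(x)=\|x-\mathrm{prox}_{f_1}(x-\nabla f_2(x))\|$ and $\varphi(x)=\min_{y\in\bar X^*}\|x-y\|$ for $x\in X$. Local error bound property: for every $\nu\ge\inf_{x\in X}F(x)$ there exist $\delta>0$ and $\tau>0$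 such that $\varphi(x)\le\tau\psi(x)$ for all $x\in X$ with $F(x)\le\nu$ and $\psi(x)\le\delta$. APS method with constant $\kappa$: it generates a sequence $x^0,x^1,\dots$ in $X$ such that $x^{r+1}=\mathrm{prox}_{\alpha^r f_1}\big(x^r-\alpha^r(\nabla f_2(x^r)+e^r)\big)$ for $r=0,1,\dots$, where $\{\alpha^r\}$ is a sequence of positive scalars with $\liminf_r\alpha^r>0$ and $\{e^r\}$ is a sequence in $\mathbb{R}^n$ with $\|e^r\|\le\kappa\|x^r-x^{r+1}\|$ for all $r$. *)

theory Defs
  imports "HOL-Analysis.Analysis"
begin

text \<open>Convexity and closedness of an extended-real-valued function are those of its epigraph in
  \<open>'a \<times> real\<close>; the library's \<open>epigraph\<close> and \<open>convex_on\<close> only cover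
  real-valued functions.\<close>

definition ext_epigraph :: "('a \<Rightarrow> ereal) \<Rightarrow> ('a \<times> real) set" where
  "ext_epigraph f = {(x, t). f x \<le> ereal t}"

definition proper_closed_convex :: "('a::euclidean_space \<Rightarrow> ereal) \<Rightarrow> bool" where
  "proper_closed_convex f \<longleftrightarrow>
     (\<forall>x. f x \<noteq> -\<infinity>) \<and> (\<exists>x. f x \<noteq> \<infinity>) \<and>
     closed (ext_epigraph f) \<and> convex (ext_epigraph f)"

text \<open>If \<open>X\<close> is nonempty, closed and convex and \<open>h\<close> is proper closed convex and finite
  somewhere on \<open>X\<close>, the objective below has exactly one minimizer over \<open>X\<close>, so the
  choice made by \<open>arg_min_on\<close> is determined.\<close>

definition prox :: "'a::euclidean_space set \<Rightarrow> ('a \<Rightarrow> ereal) \<Rightarrow> 'a \<Rightarrow> 'a" where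
  "prox X h x = arg_min_on (\<lambda>y. h y + ereal (1/2 * (norm (y - x))\<^sup>2)) X"

definition objective :: "('a \<Rightarrow> ereal) \<Rightarrow> ('a \<Rightarrow> real) \<Rightarrow> 'a \<Rightarrow> ereal" where
  "objective f1 f2 x = f1 x + ereal (f2 x)"

definition minimizers :: "'a set \<Rightarrow> ('a \<Rightarrow> ereal) \<Rightarrow> 'a set" where
  "minimizers X F = {x. is_arg_min F (\<lambda>y. y \<in> X) x}"

text \<open>In the following definitions \<open>g\<close> stands for the gradient of \<open>f2\<close>.\<close>

definition prox_residual ::
  "'a::euclidean_space set \<Rightarrow> ('a \<Rightarrow> ereal) \<Rightarrow> ('a \<Rightarrow> 'a) \<Rightarrow> 'a \<Rightarrow> real" where
  "prox_residual X f1 g x = norm (x - prox X f1 (x - g x))"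

text \<open>The minimum distance to the closure of the (nonempty) solution set is \<open>infdist\<close>; the
  infimum is attained because the closure is closed and nonempty.\<close>

definition local_error_bound ::
  "'a::euclidean_space set \<Rightarrow> ('a \<Rightarrow> ereal) \<Rightarrow> ('a \<Rightarrow> real) \<Rightarrow> ('a \<Rightarrow> 'a) \<Rightarrow> bool" where
  "local_error_bound X f1 f2 g \<longleftrightarrow>
     (\<forall>\<nu>::real. (INF x\<in>X. objective f1 f2 x) \<le> ereal \<nu> \<longrightarrow>
        (\<exists>\<delta>>0. \<exists>\<tau>>0. \<forall>x\<in>X.
           objective f1 f2 x \<le> ereal \<nu> \<and> prox_residual X f1 g x \<le> \<delta> \<longrightarrow>
           infdist x (closure (minimizers X (objective f1 f2))) \<le> \<tau> * prox_residual X f1 g x))"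

definition APS_sequence ::
  "'a::euclidean_space set \<Rightarrow> ('a \<Rightarrow> ereal) \<Rightarrow> ('a \<Rightarrow> 'a) \<Rightarrow> real \<Rightarrow>
   (nat \<Rightarrow> real) \<Rightarrow> (nat \<Rightarrow> 'a) \<Rightarrow> (nat \<Rightarrow> 'a) \<Rightarrow> bool" where
  "APS_sequence X f1 g \<kappa> \<alpha> e x \<longleftrightarrow>
     (\<forall>r. x r \<in> X) \<and>
     (\<forall>r. \<alpha> r > 0) \<and> liminf (\<lambda>r. ereal (\<alpha> r)) > 0 \<and>
     (\<forall>r. norm (e r) \<le> \<kappa> * norm (x r - x (Suc r))) \<and>
     (\<forall>r. x (Suc r) =
        prox X (\<lambda>y. ereal (\<alpha> r) * f1 y) (x r - \<alpha> r *\<^sub>R (g (x r) + e r)))"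

definition R_linearly_converges :: "(nat \<Rightarrow> 'a::real_normed_vector) \<Rightarrow> 'a \<Rightarrow> bool" where
  "R_linearly_converges x l \<longleftrightarrow>
     (\<exists>C q. C \<ge> 0 \<and> 0 < q \<and> q < 1 \<and>
        (\<forall>\<^sub>F r in sequentially. norm (x r - l) \<le> C * q ^ r))"

end

theory Submission
  imports Defs
begin

text \<open>Write \<open>y\<close> for the iterate following \<open>x\<close>. The proximal step is characterized by the variational inequality
  \<open>f\<^sub>1 y + \<langle>v, z - y\<rangle> \<le> f\<^sub>1 z\<close> on \<open>X\<close> with \<open>v = (x - y) / \<alpha> - \<nabla>f\<^sub>2 x - e\<close>, so that
  \<open>w = v + \<nabla>f\<^sub>2 y\<close> satisfies \<open>\<parallel>w\<parallel> \<le> K \<parallel>x - y\<parallel>\<close>.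
  The point \<open>y\<close> is itself the unit-step proximal point of \<open>y + v\<close>, hence nonexpansiveness bounds the
  residual at \<open>y\<close> by \<open>\<parallel>w\<parallel>\<close>; evaluating at \<open>y\<close> rather than \<open>x\<close> avoids any upper bound on the
  stepsizes. Convexity bounds the gap \<open>F y - min F\<close> by \<open>\<parallel>w\<parallel>\<close> times the distance to the solutions, and the
  error bound turns this into \<open>F y - min F \<le> \<tau> K\<^sup>2 \<parallel>x - y\<parallel>\<^sup>2\<close>. Together with sufficient decrease the
  gaps, and therefore the step lengths, decay geometrically.\<close>

section \<open>Existence of minimizers for extended-real-valued functions\<close>

text \<open>Among finitely many points of \<open>K\<close>, one with least value lies in all their
  sublevel sets. These sets thus have the finite intersection property, and a common point of all of
  them is a minimizer.\<close>

lemma compact_attains_min_ereal: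
  fixes f :: "'a::heine_borel \<Rightarrow> ereal"
  assumes "compact K" "K \<noteq> {}" and cl: "\<And>z. z \<in> K \<Longrightarrow> closed {y \<in> K. f y \<le> f z}"
  shows "\<exists>p\<in>K. \<forall>z\<in>K. f p \<le> f z"
proof -
  let ?C = "\<lambda>z. {y \<in> K. f y \<le> f z}"
  have "K \<inter> \<Inter>(?C ` K) \<noteq> {}"
  proof (rule compact_imp_fip[OF \<open>compact K\<close>])
    show "closed T" if "T \<in> ?C ` K" for T using that cl by auto
    fix G assume "finite G" "G \<subseteq> ?C ` K"
    then obtain Z where Z: "finite Z" "Z \<subseteq> K" "G = ?C ` Z"
      by (meson finite_subset_image)
    show "K \<inter> \<Inter>G \<noteq> {}"
    proof (cases "Z = {}")
      case True then show ?thesis using Z \<open>K \<noteq> {}\<close> by simp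
    next
      case False
      then obtain w where "w \<in> Z" "\<forall>z\<in>Z. f w \<le> f z"
        using Z(1) by (metis arg_min_if_finite(1) arg_min_least)
      then show ?thesis using Z by blast
    qed
  qed
  then show ?thesis by blast
qed

text \<open>For a finite level \<open>r\<close>, the continuous term moves into the level: the set
  is, within \<open>K\<close>, the preimage of the closed epigraph under
  \<open>y \<mapsto> (y, r - q y)\<close>.\<close>

lemma closed_sublevel_add_continuous:
  fixes h :: "'a::euclidean_space \<Rightarrow> ereal"
  assumes h: "proper_closed_convex h" and q: "continuous_on UNIV q" and K: "closed K"
  shows "closed {y \<in> K. h y + ereal (q y) \<le> c}"
proof (cases c)
  case (real r)
  have "{y \<in> K. h y + ereal (q y) \<le> c} = K \<inter> (\<lambda>y. (y, r - q y)) -` ext_epigraph h"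
    (is "?A = ?B")
  proof -
    have "h y + ereal (q y) \<le> ereal r \<longleftrightarrow> h y \<le> ereal (r - q y)" for y
      by (cases "h y") auto
    then show ?thesis unfolding ext_epigraph_def real by auto
  qed
  moreover have "closed ((\<lambda>y. (y, r - q y)) -` ext_epigraph h)"
    using h q unfolding proper_closed_convex_def
    by (intro continuous_closed_vimage) (auto intro!: continuous_intros simp: continuous_on_eq_continuous_at)
  ultimately show ?thesis using K by (simp add: closed_Int)
next
  case PInf then show ?thesis using K by simp
next
  case MInf
  have "h y \<noteq> -\<infinity>" for y using h by (simp add: proper_closed_convex_def)
  then have "{y \<in> K. h y + ereal (q y) \<le> c} = {}" using MInf by auto
  then show ?thesis by (metis closed_empty)
qed

lemma ext_convexD:
  assumes "convex (ext_epigraph h)" "h x \<le> ereal a" "h y \<le> ereal b" "0 \<le> t" "t \<le> 1"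
  shows "h ((1 - t) *\<^sub>R x + t *\<^sub>R y) \<le> ereal ((1 - t) * a + t * b)"
  using convexD_alt[OF assms(1), of "(x, a)" "(y, b)" t] assms(2-)
  by (simp add: ext_epigraph_def)

text \<open>Scaling by \<open>a\<close> pulls the epigraph back along a continuous linear rescaling
  of the height coordinate.\<close>

lemma proper_closed_convex_scale:
  assumes h: "proper_closed_convex h" and "a > 0"
  shows "proper_closed_convex (\<lambda>y. ereal a * h y)"
proof -
  let ?s = "\<lambda>p :: 'a \<times> real. (fst p, snd p / a)"
  have eq: "ext_epigraph (\<lambda>y. ereal a * h y) = ?s -` ext_epigraph h"
  proof -
    have "ereal a * h y \<le> ereal t \<longleftrightarrow> h y \<le> ereal (t / a)" for y t
      using \<open>a > 0\<close> by (cases "h y") (auto simp: field_simps)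
    then show ?thesis by (auto simp: ext_epigraph_def)
  qed
  have "linear ?s" by (auto simp: linear_iff add_divide_distrib)
  moreover have "closed (?s -` ext_epigraph h)"
    using h \<open>a > 0\<close> unfolding proper_closed_convex_def
    by (intro continuous_closed_vimage) (auto intro!: continuous_intros)
  ultimately show ?thesis
    using h \<open>a > 0\<close> unfolding proper_closed_convex_def eq
    by (auto intro: convex_linear_vimage)
qed

text \<open>Supplies the coercivity of the proximal objective. On the unit ball around
  \<open>y0\<close>, \<open>h\<close> has a finite minimum \<open>m\<close>; convexity along rays
  from \<open>y0\<close> turns the greatest possible drop \<open>t0 - m\<close> over distance one
  into a bound on the slope.\<close>

lemma proper_closed_convex_linear_minorant:
  fixes h :: "'a::euclidean_space \<Rightarrow> ereal"
  assumes h: "proper_closed_convex h" and y0: "h y0 = ereal t0"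
  shows "\<exists>B\<ge>0. \<forall>y. norm (y - y0) \<ge> 1 \<longrightarrow> ereal (t0 - norm (y - y0) * B) \<le> h y"
proof -
  have "\<exists>p\<in>cball y0 1. \<forall>z\<in>cball y0 1. h p \<le> h z"
    using closed_sublevel_add_continuous[OF h, of "\<lambda>_. 0" "cball y0 1"]
    by (intro compact_attains_min_ereal) (auto simp flip: zero_ereal_def)
  then obtain p where p: "p \<in> cball y0 1" "\<And>z. z \<in> cball y0 1 \<Longrightarrow> h p \<le> h z" by blast
  have "h p \<le> ereal t0" using p(2)[of y0] y0 by simp
  moreover have "h p \<noteq> -\<infinity>" using h by (simp add: proper_closed_convex_def)
  ultimately obtain m where m: "h p = ereal m" "m \<le> t0" by (cases "h p") auto
  have "ereal (t0 - norm (y - y0) * (t0 - m)) \<le> h y" if s: "norm (y - y0) \<ge> 1" for y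
  proof (cases "h y")
    case (real b)
    define s where "s = norm (y - y0)"
    \<comment> \<open>The point where the segment from \<open>y0\<close> to \<open>y\<close> crosses
      the unit sphere around \<open>y0\<close>; there \<open>h\<close> is at least
      \<open>m\<close>.\<close>
    let ?w = "(1 - 1/s) *\<^sub>R y0 + (1/s) *\<^sub>R y"
    have "s \<ge> 1" using that by (simp add: s_def)
    have "?w - y0 = (1/s) *\<^sub>R (y - y0)" by (simp add: algebra_simps)
    then have "norm (?w - y0) = 1" using \<open>s \<ge> 1\<close> by (simp add: s_def[symmetric])
    then have "h p \<le> h ?w" by (intro p(2)) (simp add: dist_norm norm_minus_commute)
    also have "\<dots> \<le> ereal ((1 - 1/s) * t0 + (1/s) * b)"
      using h y0 real \<open>s \<ge> 1\<close> by (intro ext_convexD) (auto simp: proper_closed_convex_def)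
    finally have "m \<le> (1 - 1/s) * t0 + (1/s) * b" using m by simp
    then have "s * m \<le> s * ((1 - 1/s) * t0 + (1/s) * b)"
      using \<open>s \<ge> 1\<close> by (intro mult_left_mono) auto
    also have "\<dots> = (s - 1) * t0 + b" using \<open>s \<ge> 1\<close> by (simp add: field_simps)
    finally show ?thesis using real by (simp add: algebra_simps flip: s_def)
  qed (use h in \<open>auto simp: proper_closed_convex_def\<close>)
  then show ?thesis using m(2) by (intro exI[of _ "t0 - m"]) auto
qed

text \<open>A minimizer over the part of \<open>X\<close> in a large ball around \<open>y0\<close>
  is global, because outside the ball the objective is at least its value at
  \<open>y0\<close>.\<close>

lemma prox_objective_attains_min:
  fixes h :: "'a::euclidean_space \<Rightarrow> ereal"
  assumes h: "proper_closed_convex h" and X: "closed X" and y0: "y0 \<in> X" "\<bar>h y0\<bar> \<noteq> \<infinity>"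
  shows "\<exists>p\<in>X. \<forall>z\<in>X. h p + ereal (1/2 * (norm (p - u))\<^sup>2) \<le> h z + ereal (1/2 * (norm (z - u))\<^sup>2)"
proof -
  let ?q = "\<lambda>y. 1/2 * (norm (y - u))\<^sup>2"
  let ?f = "\<lambda>y. h y + ereal (?q y)"
  obtain t0 where t0: "h y0 = ereal t0" using y0(2) by (cases "h y0") auto
  obtain B where B: "B \<ge> 0"
    "\<And>y. norm (y - y0) \<ge> 1 \<Longrightarrow> ereal (t0 - norm (y - y0) * B) \<le> h y"
    using proper_closed_convex_linear_minorant[OF h t0] by blast
  define d where "d = norm (y0 - u)"
  \<comment> \<open>Outside this radius the quadratic term outweighs the linear decrease of the minorant.\<close>
  define R where "R = max 1 (2 * (d + B))"
  let ?K = "X \<inter> cball y0 R"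
  have y0K: "y0 \<in> ?K" using y0 by (simp add: R_def)
  have cK: "compact ?K" using X by (simp add: closed_Int_compact)
  have "\<exists>p\<in>?K. \<forall>z\<in>?K. ?f p \<le> ?f z"
  proof (rule compact_attains_min_ereal[OF cK])
    show "?K \<noteq> {}" using y0K by blast
    show "closed {y \<in> ?K. ?f y \<le> ?f z}" for z
      by (intro closed_sublevel_add_continuous[OF h]) (auto intro!: continuous_intros compact_imp_closed[OF cK])
  qed
  then obtain p where p: "p \<in> ?K" "\<And>z. z \<in> ?K \<Longrightarrow> ?f p \<le> ?f z" by blast
  have "?f p \<le> ?f z" if "z \<in> X" for z
  proof (cases "norm (z - y0) \<le> R")
    case True then show ?thesis using that by (intro p(2)) (simp add: dist_norm norm_minus_commute)
  next
    case False
    define s where "s = norm (z - y0)"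
    have s: "s \<ge> 1" "s \<ge> 2 * (d + B)" using False by (auto simp: R_def s_def)
    have "d \<ge> 0" by (simp add: d_def)
    have tri: "s - d \<le> norm (z - u)"
      using norm_triangle_ineq[of "z - u" "u - y0"] by (simp add: s_def d_def norm_minus_commute)
    have "(s - d)\<^sup>2 \<le> (norm (z - u))\<^sup>2"
      using s \<open>d \<ge> 0\<close> \<open>B \<ge> 0\<close> by (intro power_mono[OF tri]) auto
    \<comment> \<open>Half of this product is exactly the difference
      \<open>1/2 * (s - d)\<^sup>2 - s * B - 1/2 * d\<^sup>2\<close>.\<close>
    moreover have "0 \<le> s * (s - 2 * (d + B))" using s by simp
    ultimately have *: "t0 + 1/2 * d\<^sup>2 \<le> (t0 - s * B) + ?q z"
      by (simp add: power2_eq_square algebra_simps)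
    have "?f p \<le> ?f y0" using p(2)[OF y0K] .
    also have "\<dots> = ereal (t0 + 1/2 * d\<^sup>2)" by (simp add: t0 d_def)
    also have "\<dots> \<le> ereal (t0 - s * B) + ereal (?q z)" using * by simp
    also have "\<dots> \<le> ?f z" using B(2)[of z] s by (intro add_right_mono) (simp add: s_def)
    finally show ?thesis .
  qed
  then show ?thesis using p(1) by blast
qed

section \<open>Variational inequality of the proximal step\<close>

text \<open>Optimality condition for \<open>p\<close> minimizing \<open>h y + \<parallel>y - u\<parallel>\<^sup>2 / 2\<close> over \<open>X\<close>.\<close>

definition prox_vi :: "'a::euclidean_space set \<Rightarrow> ('a \<Rightarrow> ereal) \<Rightarrow> 'a \<Rightarrow> 'a \<Rightarrow> bool" where
  "prox_vi X h u p \<longleftrightarrow> p \<in> X \<and> \<bar>h p\<bar> \<noteq> \<infinity> \<and>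
     (\<forall>z\<in>X. h p + ereal ((u - p) \<bullet> (z - p)) \<le> h z)"

lemma le_if_le_plus_small_multiples:
  fixes a b :: real
  assumes "\<And>t. 0 < t \<Longrightarrow> t < 1 \<Longrightarrow> a \<le> b + t * c"
  shows "a \<le> b"
proof (rule tendsto_lowerbound)
  show "((\<lambda>t. b + t * c) \<longlongrightarrow> b) (at_right 0)"
    by (auto intro!: tendsto_eq_intros)
  show "\<forall>\<^sub>F t in at_right 0. a \<le> b + t * c"
    using assms eventually_at_right_real[of 0 1] by (auto elim!: eventually_mono)
qed simp

text \<open>Compare the minimizer \<open>p\<close> with the points \<open>(1 - t) p + t z\<close> of
  the segment towards \<open>z\<close>. Convexity bounds \<open>h\<close> there, the quadratic term
  differs to first order by the inner product, and dividing by \<open>t\<close> and letting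
  \<open>t\<close> tend to 0 leaves the inequality.\<close>

lemma prox_vi_prox:
  fixes h :: "'a::euclidean_space \<Rightarrow> ereal"
  assumes h: "proper_closed_convex h" and X: "closed X" "convex X"
    and y0: "y0 \<in> X" "\<bar>h y0\<bar> \<noteq> \<infinity>"
  shows "prox_vi X h u (prox X h u)"
proof -
  let ?f = "\<lambda>y. h y + ereal (1/2 * (norm (y - u))\<^sup>2)"
  define p where "p = prox X h u"
  have "\<exists>p. is_arg_min ?f (\<lambda>y. y \<in> X) p"
    using prox_objective_attains_min[OF h X(1) y0, of u] unfolding is_arg_min_linorder by blast
  then have "is_arg_min ?f (\<lambda>y. y \<in> X) p"
    unfolding p_def prox_def arg_min_on_def arg_min_def by (rule someI_ex)
  then have p: "p \<in> X" "\<And>z. z \<in> X \<Longrightarrow> ?f p \<le> ?f z" by (auto simp: is_arg_min_linorder)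
  have nm: "h y \<noteq> -\<infinity>" for y using h by (simp add: proper_closed_convex_def)
  have "h p \<noteq> \<infinity>" using p(2)[OF y0(1)] y0(2) by auto
  then obtain b where b: "h p = ereal b" using nm[of p] by (cases "h p") auto
  have "h p + ereal ((u - p) \<bullet> (z - p)) \<le> h z" if z: "z \<in> X" for z
  proof (cases "h z")
    case (real a)
    have "b + (u - p) \<bullet> (z - p) \<le> a + t * ((norm (z - p))\<^sup>2 / 2)" if t: "0 < t" "t < 1" for t
    proof -
      let ?w = "(1 - t) *\<^sub>R p + t *\<^sub>R z"
      have "?w \<in> X" using X(2) p(1) z t by (simp add: convexD_alt)
      then have "?f p \<le> ?f ?w" by (rule p(2))
      also have "\<dots> \<le> ereal ((1 - t) * b + t * a) + ereal (1/2 * (norm (?w - u))\<^sup>2)"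
        using h b real t by (intro add_right_mono ext_convexD) (auto simp: proper_closed_convex_def)
      finally have "b + 1/2 * (norm (p - u))\<^sup>2 \<le> (1 - t) * b + t * a + 1/2 * (norm (?w - u))\<^sup>2"
        using b by simp
      moreover have "?w - u = (p - u) + t *\<^sub>R (z - p)" by (simp add: algebra_simps)
      then have "(norm (?w - u))\<^sup>2 = (norm (p - u))\<^sup>2 - 2 * t * ((u - p) \<bullet> (z - p)) + t\<^sup>2 * (norm (z - p))\<^sup>2"
        unfolding power2_norm_eq_inner
        by (simp add: inner_add inner_diff power2_eq_square inner_commute algebra_simps)
      ultimately have "t * (b + (u - p) \<bullet> (z - p)) \<le> t * (a + t * ((norm (z - p))\<^sup>2 / 2))"
        by (simp add: algebra_simps power2_eq_square)
      then show ?thesis using t by simp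
    qed
    then have "b + (u - p) \<bullet> (z - p) \<le> a" by (rule le_if_le_plus_small_multiples)
    then show ?thesis using b real by simp
  qed (use nm[of z] in auto)
  then show ?thesis unfolding prox_vi_def p_def[symmetric] using p(1) b by auto
qed

text \<open>Testing each inequality at the other point and adding cancels the values of
  \<open>h\<close>. What remains is firm nonexpansiveness, to which Cauchy-Schwarz applies.\<close>

lemma prox_vi_nonexpansive:
  assumes "prox_vi X h u p" "prox_vi X h v q"
  shows "norm (p - q) \<le> norm (u - v)"
proof -
  obtain a b where "h p = ereal a" "h q = ereal b"
    using assms unfolding prox_vi_def by (metis ereal_real')
  moreover have "h p + ereal ((u - p) \<bullet> (q - p)) \<le> h q" "h q + ereal ((v - q) \<bullet> (p - q)) \<le> h p"
    using assms by (auto simp: prox_vi_def)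
  ultimately have "(u - p) \<bullet> (q - p) + (v - q) \<bullet> (p - q) \<le> 0" by simp
  moreover have "(u - p) \<bullet> (q - p) + (v - q) \<bullet> (p - q) = (norm (p - q))\<^sup>2 - (u - v) \<bullet> (p - q)"
    unfolding power2_norm_eq_inner by (simp add: inner_diff inner_commute algebra_simps)
  ultimately have "norm (p - q) * norm (p - q) \<le> norm (u - v) * norm (p - q)"
    using norm_cauchy_schwarz[of "u - v" "p - q"] by (simp add: power2_eq_square)
  then show ?thesis
    by (cases "p = q") (simp_all add: mult_le_cancel_right)
qed

text \<open>Dividing the inequality by \<open>a\<close> trades stepsize \<open>a\<close> for a unit
  step whose center is shifted so that the proximal point stays at \<open>p\<close>.\<close>

lemma prox_vi_scale:
  assumes "prox_vi X (\<lambda>y. ereal a * h y) (x - a *\<^sub>R w) p" "a > 0"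
  shows "prox_vi X h (p + ((1/a) *\<^sub>R (x - p) - w)) p"
proof -
  have hp: "p \<in> X" "\<bar>ereal a * h p\<bar> \<noteq> \<infinity>"
    "\<And>z. z \<in> X \<Longrightarrow> ereal a * h p + ereal ((x - a *\<^sub>R w - p) \<bullet> (z - p)) \<le> ereal a * h z"
    using assms(1) unfolding prox_vi_def by auto
  obtain b where b: "h p = ereal b" using hp(2) \<open>a > 0\<close> by (cases "h p") auto
  have "h p + ereal (((1/a) *\<^sub>R (x - p) - w) \<bullet> (z - p)) \<le> h z" if "z \<in> X" for z
  proof (cases "h z")
    case (real c)
    have "a * b + (x - a *\<^sub>R w - p) \<bullet> (z - p) \<le> a * c" using hp(3)[OF that] b real by simp
    moreover have "x - a *\<^sub>R w - p = a *\<^sub>R ((1/a) *\<^sub>R (x - p) - w)"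
      using \<open>a > 0\<close> by (simp add: scaleR_diff_right)
    ultimately have "a * (b + ((1/a) *\<^sub>R (x - p) - w) \<bullet> (z - p)) \<le> a * c"
      by (simp add: algebra_simps)
    then show ?thesis using b real \<open>a > 0\<close> by simp
  next
    case MInf
    then show ?thesis using hp(3)[OF that] b \<open>a > 0\<close> by simp
  qed simp
  then show ?thesis using hp(1) b by (simp add: prox_vi_def)
qed

section \<open>First-order inequality for the smooth term\<close>

text \<open>Restricting \<open>f\<close> to the line through \<open>y\<close> and \<open>z\<close>
  reduces this to the tangent inequality in one variable, between parameters 0 and 1.\<close>

lemma convex_gradient_inequality:
  fixes f :: "'a::real_inner \<Rightarrow> real"
  assumes "convex_on UNIV f" "GDERIV f y :> d"
  shows "f y + d \<bullet> (z - y) \<le> f z"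
proof -
  let ?l = "\<lambda>t::real. y + t *\<^sub>R (z - y)"
  have "convex_on UNIV (\<lambda>t. f (?l t))"
  proof (rule convex_onI)
    fix t a b :: real assume t: "0 < t" "t < 1"
    have "?l ((1 - t) *\<^sub>R a + t *\<^sub>R b) = (1 - t) *\<^sub>R ?l a + t *\<^sub>R ?l b" by (simp add: algebra_simps)
    then show "f (?l ((1 - t) *\<^sub>R a + t *\<^sub>R b)) \<le> (1 - t) * f (?l a) + t * f (?l b)"
      using convex_onD[OF assms(1), of t "?l a" "?l b"] t by simp
  qed simp
  moreover have "((\<lambda>t. f (?l t)) has_field_derivative d \<bullet> (z - y)) (at 0 within UNIV)"
  proof -
    have "(?l has_derivative (\<lambda>t. t *\<^sub>R (z - y))) (at 0)"
      by (auto intro!: derivative_eq_intros)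
    moreover have "(f has_derivative (\<lambda>v. v \<bullet> d)) (at (?l 0))"
      using assms(2) by (simp add: gderiv_def)
    ultimately have "((\<lambda>t. f (?l t)) has_derivative (\<lambda>t. (t *\<^sub>R (z - y)) \<bullet> d)) (at 0)"
      by (rule has_derivative_compose)
    then show ?thesis
      unfolding has_field_derivative_def
      by (rule has_derivative_eq_rhs) (auto simp: inner_commute)
  qed
  ultimately have "f (?l 1) - f (?l 0) \<ge> (d \<bullet> (z - y)) * (1 - 0)"
    by (intro convex_on_imp_above_tangent[where A = UNIV]) auto
  then show ?thesis by simp
qed

section \<open>Geometric decay and R-linear convergence\<close>

lemma geometric_steps_converge:
  fixes x :: "nat \<Rightarrow> 'a::banach"
  assumes q: "0 < q" "q < 1" and step: "\<And>k. norm (x (Suc k) - x k) \<le> M * q ^ k"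
  shows "\<exists>z. \<forall>k. norm (x k - z) \<le> M / (1 - q) * q ^ k"
proof -
  define y where "y k = x (Suc k) - x k" for k
  have sum0: "summable (\<lambda>k. M * q ^ k)" using q by (intro summable_mult summable_geometric) simp
  have "summable (\<lambda>k. norm (y k))"
    using step by (intro summable_comparison_test'[OF sum0, of 0]) (simp add: y_def)
  then have "summable y" by (rule summable_norm_cancel)
  then have "(\<lambda>n. \<Sum>k<n. y k) \<longlonglongrightarrow> suminf y" by (rule summable_LIMSEQ)
  moreover have "(\<Sum>k<n. y k) = x n - x 0" for n unfolding y_def by (rule sum_lessThan_telescope)
  ultimately have "(\<lambda>n. x n - x 0 + x 0) \<longlonglongrightarrow> suminf y + x 0" by (intro tendsto_intros) simp
  then have lim: "x \<longlonglongrightarrow> suminf y + x 0" (is "_ \<longlonglongrightarrow> ?z") by simp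
  have "M \<ge> 0" using order_trans[OF norm_ge_zero step[of 0]] by simp
  \<comment> \<open>The exact partial geometric sum is kept so that the induction closes; its
    subtracted term is dropped only before the limit in \<open>n\<close>.\<close>
  have part: "norm (x k - x (n + k)) \<le> M / (1 - q) * (q ^ k - q ^ (n + k))" for k n
  proof (induction n)
    case (Suc n)
    have "norm (x k - x (Suc n + k)) \<le> norm (x k - x (n + k)) + norm (x (Suc (n + k)) - x (n + k))"
      using norm_triangle_ineq4[of "x k - x (n + k)" "x (Suc (n + k)) - x (n + k)"] by simp
    also have "\<dots> \<le> M / (1 - q) * (q ^ k - q ^ (n + k)) + M * q ^ (n + k)"
      using Suc step by (intro add_mono) auto
    also have "\<dots> = M / (1 - q) * (q ^ k - q ^ (Suc n + k))" using q by (simp add: field_simps)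
    finally show ?case .
  qed simp
  have "norm (x k - ?z) \<le> M / (1 - q) * q ^ k" for k
  proof (rule tendsto_upperbound)
    show "(\<lambda>n. norm (x k - x (n + k))) \<longlonglongrightarrow> norm (x k - ?z)"
      using LIMSEQ_ignore_initial_segment[OF lim, of k] by (intro tendsto_intros)
    have "norm (x k - x (n + k)) \<le> M / (1 - q) * q ^ k" for n
    proof -
      have "M / (1 - q) * (q ^ k - q ^ (n + k)) \<le> M / (1 - q) * q ^ k"
        using q \<open>M \<ge> 0\<close> by (intro mult_left_mono) auto
      then show ?thesis using part[of k n] by linarith
    qed
    then show "\<forall>\<^sub>F n in sequentially. norm (x k - x (n + k)) \<le> M / (1 - q) * q ^ k" by simp
  qed simp
  then show ?thesis by blast
qed

lemma R_linearly_converges_tendsto: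
  assumes "R_linearly_converges x z"
  shows "x \<longlonglongrightarrow> z"
proof -
  obtain C q where *: "0 < q" "q < 1" "\<forall>\<^sub>F r in sequentially. norm (x r - z) \<le> C * q ^ r"
    using assms unfolding R_linearly_converges_def by blast
  have "(\<lambda>r. C * q ^ r) \<longlonglongrightarrow> C * 0" using * by (intro tendsto_mult_left LIMSEQ_power_zero) simp
  then have "(\<lambda>r. x r - z) \<longlonglongrightarrow> 0" using *(3) by (auto intro: Lim_null_comparison)
  then show ?thesis by (simp add: LIM_zero_iff)
qed

lemma R_linearly_converges_shift:
  assumes "R_linearly_converges (\<lambda>k. x (k + N)) z"
  shows "R_linearly_converges x z"
proof -
  obtain C q where *: "C \<ge> 0" "0 < q" "q < 1" "\<forall>\<^sub>F r in sequentially. norm (x (r + N) - z) \<le> C * q ^ r"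
    using assms unfolding R_linearly_converges_def by blast
  then obtain m where m: "\<And>r. r \<ge> m \<Longrightarrow> norm (x (r + N) - z) \<le> C * q ^ r"
    by (auto simp: eventually_sequentially)
  have "norm (x r - z) \<le> C / q ^ N * q ^ r" if "r \<ge> m + N" for r
    using m[of "r - N"] that * by (simp add: power_diff)
  then show ?thesis unfolding R_linearly_converges_def
    using * by (intro exI[of _ "C / q ^ N"] exI[of _ q]) (auto simp: eventually_sequentially)
qed

text \<open>The two inequalities force \<open>D\<close> to contract by the factor
  \<open>\<rho>\<close>. Sufficient decrease bounds the squared step by \<open>D r / c\<close>, so
  the steps decay at rate \<open>sqrt \<rho>\<close>.\<close>

lemma R_linearly_converges_if_gap_le_step:
  fixes x :: "nat \<Rightarrow> 'a::banach" and D :: "nat \<Rightarrow> real"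
  assumes D0: "\<And>r. D r \<ge> 0" and c: "c > 0" and K: "K > 0"
    and dec: "\<And>r. D (Suc r) + c * (norm (x (Suc r) - x r))\<^sup>2 \<le> D r"
    and gap: "\<And>r. D (Suc r) \<le> K * (norm (x (Suc r) - x r))\<^sup>2"
  shows "\<exists>z. R_linearly_converges x z"
proof -
  define \<rho> where "\<rho> = K / (K + c)"
  have \<rho>: "0 < \<rho>" "\<rho> < 1" using c K by (auto simp: \<rho>_def)
  have D1: "D (Suc r) \<le> \<rho> * D r" for r
  proof -
    \<comment> \<open>Weights \<open>c\<close> and \<open>K\<close> make the squared steps cancel
      when the two inequalities are added.\<close>
    have "c * D (Suc r) \<le> c * (K * (norm (x (Suc r) - x r))\<^sup>2)" using gap c by simp
    moreover have "K * (D (Suc r) + c * (norm (x (Suc r) - x r))\<^sup>2) \<le> K * D r" using dec K by simp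
    ultimately have "(K + c) * D (Suc r) \<le> K * D r" by (simp add: algebra_simps)
    then show ?thesis using c K by (simp add: \<rho>_def field_simps)
  qed
  have Dg: "D r \<le> D 0 * \<rho> ^ r" for r
  proof (induction r)
    case (Suc r)
    have "\<rho> * D r \<le> \<rho> * (D 0 * \<rho> ^ r)" using Suc \<rho> by simp
    then show ?case using D1[of r] by (simp add: mult_ac)
  qed simp
  define M where "M = sqrt (D 0 / c)"
  have step: "norm (x (Suc r) - x r) \<le> M * sqrt \<rho> ^ r" for r
  proof -
    have "c * (norm (x (Suc r) - x r))\<^sup>2 \<le> D 0 * \<rho> ^ r"
      using dec[of r] D0[of "Suc r"] Dg[of r] by linarith
    then have "(norm (x (Suc r) - x r))\<^sup>2 \<le> D 0 / c * \<rho> ^ r" using c by (simp add: field_simps)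
    then have "norm (x (Suc r) - x r) \<le> sqrt (D 0 / c * \<rho> ^ r)" by (rule real_le_rsqrt)
    then show ?thesis by (simp only: M_def real_sqrt_mult real_sqrt_power)
  qed
  have q: "0 < sqrt \<rho>" "sqrt \<rho> < 1" using \<rho> by auto
  obtain z where "\<And>k. norm (x k - z) \<le> M / (1 - sqrt \<rho>) * sqrt \<rho> ^ k"
    using geometric_steps_converge[where x = x, OF q step] by blast
  moreover have "M / (1 - sqrt \<rho>) \<ge> 0" using q D0 c by (simp add: M_def)
  ultimately show ?thesis unfolding R_linearly_converges_def using q
    by (intro exI[of _ z] exI[of _ "M / (1 - sqrt \<rho>)"] exI[of _ "sqrt \<rho>"]) simp
qed

text \<open>A decreasing sequence bounded below converges, so its successive differences vanish, and
  they dominate the squared steps. This makes the residual small before the error bound can be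
  invoked.\<close>

lemma steps_tendsto_0_if_sufficient_decrease:
  fixes x :: "nat \<Rightarrow> 'a::real_normed_vector" and D :: "nat \<Rightarrow> real"
  assumes D0: "\<And>r. D r \<ge> 0" and c: "c > 0"
    and dec: "\<And>r. D (Suc r) + c * (norm (x (Suc r) - x r))\<^sup>2 \<le> D r"
  shows "(\<lambda>r. norm (x (Suc r) - x r)) \<longlonglongrightarrow> 0"
proof -
  have "D (Suc r) \<le> D r" for r
  proof -
    have "0 \<le> c * (norm (x (Suc r) - x r))\<^sup>2" using c by simp
    then show ?thesis using dec[of r] by linarith
  qed
  then have "decseq D" by (simp add: decseq_Suc_iff)
  then obtain l where l: "D \<longlonglongrightarrow> l" using D0 decseq_convergent[of D 0] by blast
  have "(\<lambda>r. (D r - D (Suc r)) / c) \<longlonglongrightarrow> (l - l) / c"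
    using c by (intro tendsto_intros l LIMSEQ_Suc) auto
  then have lim: "(\<lambda>r. (D r - D (Suc r)) / c) \<longlonglongrightarrow> 0" by (simp only: diff_self div_0)
  have "\<forall>r. norm ((norm (x (Suc r) - x r))\<^sup>2) \<le> (D r - D (Suc r)) / c"
  proof
    show "norm ((norm (x (Suc r) - x r))\<^sup>2) \<le> (D r - D (Suc r)) / c" for r
      using dec[of r] c by (simp add: field_simps)
  qed
  then have "(\<lambda>r. (norm (x (Suc r) - x r))\<^sup>2) \<longlonglongrightarrow> 0"
    by (rule Lim_null_comparison[OF always_eventually lim])
  then have "(\<lambda>r. sqrt ((norm (x (Suc r) - x r))\<^sup>2)) \<longlonglongrightarrow> sqrt 0" by (intro tendsto_intros)
  then show ?thesis by simp
qed

section \<open>Optimality gap, limit points and the APS step\<close>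

text \<open>Here \<open>v\<close> acts as a subgradient of \<open>f1\<close> relative to
  \<open>X\<close> at \<open>y\<close>, and \<open>d\<close> is the gradient of \<open>f2\<close>
  there. Adding both first-order inequalities at the solution \<open>s\<close> leaves a single inner
  product for Cauchy-Schwarz.\<close>

lemma objective_gap_le:
  fixes f2 :: "'a::euclidean_space \<Rightarrow> real"
  assumes vi: "prox_vi X f1 (y + v) y" and f2: "convex_on UNIV f2" "GDERIV f2 y :> d"
    and s: "s \<in> X" "objective f1 f2 s = ereal m" and b: "f1 y = ereal b"
  shows "b + f2 y - m \<le> norm (v + d) * dist y s"
proof -
  have f1s: "f1 s = ereal (m - f2 s)" using s(2) unfolding objective_def by (cases "f1 s") auto
  have "f1 y + ereal ((y + v - y) \<bullet> (s - y)) \<le> f1 s"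
    using vi s(1) unfolding prox_vi_def by blast
  then have "b + v \<bullet> (s - y) \<le> m - f2 s" by (simp add: f1s b)
  moreover have "f2 y + d \<bullet> (s - y) \<le> f2 s" by (rule convex_gradient_inequality[OF f2])
  ultimately have "b + f2 y - m \<le> (v + d) \<bullet> (y - s)"
    by (simp add: inner_add_left inner_diff_right)
  also have "\<dots> \<le> norm (v + d) * dist y s" unfolding dist_norm by (rule norm_cauchy_schwarz)
  finally show ?thesis .
qed

text \<open>Lower semicontinuity through the closed epigraph: a vanishing gap makes
  \<open>b n\<close> tend to \<open>m - f2 z\<close>, so the limit of the points
  \<open>(y n, b n)\<close> still lies in the epigraph of \<open>f1\<close>.\<close>

lemma limit_in_minimizers:
  fixes f2 :: "'a::euclidean_space \<Rightarrow> real"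
  assumes f1: "proper_closed_convex f1" and X: "closed X" and f2: "isCont f2 z"
    and s: "s \<in> minimizers X (objective f1 f2)" "objective f1 f2 s = ereal m"
    and y: "\<And>n. y n \<in> X" "y \<longlonglongrightarrow> z" "\<And>n. f1 (y n) = ereal (b n)"
    and D: "(\<lambda>n. b n + f2 (y n) - m) \<longlonglongrightarrow> 0"
  shows "z \<in> minimizers X (objective f1 f2)"
proof -
  have "(\<lambda>n. (b n + f2 (y n) - m) + m - f2 (y n)) \<longlonglongrightarrow> 0 + m - f2 z"
    by (intro tendsto_intros D isCont_tendsto_compose[OF f2] y(2))
  then have "(\<lambda>n. (y n, b n)) \<longlonglongrightarrow> (z, m - f2 z)"
    using y(2) by (intro tendsto_Pair) auto
  moreover have "(y n, b n) \<in> ext_epigraph f1" for n using y(3) by (simp add: ext_epigraph_def)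
  moreover have "closed (ext_epigraph f1)" using f1 by (simp add: proper_closed_convex_def)
  ultimately have "(z, m - f2 z) \<in> ext_epigraph f1"
    using closed_sequentially[of "ext_epigraph f1" "\<lambda>n. (y n, b n)"] by simp
  then have "objective f1 f2 z \<le> ereal m"
    unfolding objective_def ext_epigraph_def by (cases "f1 z") auto
  moreover have "z \<in> X" using X y(1,2) by (rule closed_sequentially)
  ultimately show ?thesis
    using s unfolding minimizers_def is_arg_min_linorder by (auto intro: order_trans)
qed

lemma APS_step_vi:
  assumes f1: "proper_closed_convex f1" and X: "closed X" "convex X"
    and y0: "y0 \<in> X" "\<bar>f1 y0\<bar> \<noteq> \<infinity>" and aps: "APS_sequence X f1 g \<kappa> \<alpha> e x"
  shows "prox_vi X f1 (x (Suc r) + ((1 / \<alpha> r) *\<^sub>R (x r - x (Suc r)) - (g (x r) + e r))) (x (Suc r))"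
proof -
  have a: "\<alpha> r > 0" and step: "x (Suc r) = prox X (\<lambda>y. ereal (\<alpha> r) * f1 y) (x r - \<alpha> r *\<^sub>R (g (x r) + e r))"
    using aps unfolding APS_sequence_def by blast+
  have "\<bar>ereal (\<alpha> r) * f1 y0\<bar> \<noteq> \<infinity>" using y0(2) by (cases "f1 y0") auto
  then have "prox_vi X (\<lambda>y. ereal (\<alpha> r) * f1 y) (x r - \<alpha> r *\<^sub>R (g (x r) + e r)) (x (Suc r))"
    unfolding step by (intro prox_vi_prox[OF proper_closed_convex_scale[OF f1 a] X y0(1)])
  then show ?thesis using a by (rule prox_vi_scale)
qed

section \<open>R-linear convergence of the APS iterates\<close>

theorem mainTheorem1:
  fixes X :: "(real ^ 'n) set"
    and f1 :: "real ^ 'n \<Rightarrow> ereal"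
    and f2 :: "real ^ 'n \<Rightarrow> real"
    and g :: "real ^ 'n \<Rightarrow> real ^ 'n"
    and x e :: "nat \<Rightarrow> real ^ 'n"
    and \<alpha> :: "nat \<Rightarrow> real"
    and L \<kappa> c\<^sub>1 :: real
  assumes "X \<noteq> {}" and "closed X" and "convex X"
    and "proper_closed_convex f1"
    and "\<exists>y\<in>X. \<bar>f1 y\<bar> \<noteq> \<infinity>"
    and "convex_on UNIV f2"
    and "\<And>y. GDERIV f2 y :> g y"
    and "L-lipschitz_on UNIV g"
    and "minimizers X (objective f1 f2) \<noteq> {}"
    and "local_error_bound X f1 f2 g"
    and "\<kappa> > 0"
    and "APS_sequence X f1 g \<kappa> \<alpha> e x"
    and "c\<^sub>1 > 0"
    and "\<And>r. objective f1 f2 (x r) \<ge>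
           objective f1 f2 (x (Suc r)) + ereal (c\<^sub>1 * (norm (x (Suc r) - x r))\<^sup>2)"
  shows "\<exists>z \<in> minimizers X (objective f1 f2). R_linearly_converges x z"
proof -
  let ?F = "objective f1 f2"
  let ?S = "minimizers X ?F"
  obtain y0 where y0: "y0 \<in> X" "\<bar>f1 y0\<bar> \<noteq> \<infinity>" using assms(5) by (elim bexE)
  obtain s where s: "s \<in> ?S" using assms(9) by blast
  have f1_nm: "f1 y \<noteq> -\<infinity>" for y using assms(4) by (simp add: proper_closed_convex_def)
  have S_min: "s' \<in> X" "\<And>y. y \<in> X \<Longrightarrow> ?F s' \<le> ?F y" if "s' \<in> ?S" for s'
    using that by (auto simp: minimizers_def is_arg_min_linorder)
  have "?F s \<le> ?F y0" using S_min[OF s] y0 by blast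
  moreover have "?F y0 \<noteq> \<infinity>" "?F s \<noteq> -\<infinity>"
    using y0(2) f1_nm[of s] by (auto simp: objective_def)
  ultimately obtain m where m: "?F s = ereal m" by (cases "?F s") auto
  have FS: "?F s' = ereal m" if "s' \<in> ?S" for s'
    using S_min[OF s] S_min[OF that] m by (metis antisym)
  have xX: "x r \<in> X" for r using assms(12) by (simp add: APS_sequence_def)
  have e: "norm (e r) \<le> \<kappa> * norm (x r - x (Suc r))" for r
    using assms(12) unfolding APS_sequence_def by blast

  \<comment> \<open>The objective may be infinite at \<open>x 0\<close>, so we work from \<open>x 1\<close> on.\<close>
  define y where "y r = x (Suc r)" for r
  define v where "v r = (1 / \<alpha> r) *\<^sub>R (x r - x (Suc r)) - (g (x r) + e r)" for r
  define b where "b r = real_of_ereal (f1 (y r))" for r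
  define D where "D r = b r + f2 (y r) - m" for r
  have vi: "prox_vi X f1 (y r + v r) (y r)" for r
    unfolding y_def v_def using APS_step_vi[OF assms(4,2,3) y0 assms(12)] .
  then have b: "f1 (y r) = ereal (b r)" for r
    by (auto simp: b_def prox_vi_def ereal_real')
  have Fy: "?F (y r) = ereal (D r + m)" for r by (simp add: objective_def b D_def)
  have D0: "D r \<ge> 0" for r
    using S_min(2)[OF s xX[of "Suc r"]] Fy[of r] by (simp add: m flip: y_def)
  have dec: "D (Suc r) + c\<^sub>1 * (norm (y (Suc r) - y r))\<^sup>2 \<le> D r" for r
    using assms(14)[of "Suc r"] Fy[of r] Fy[of "Suc r"] by (simp add: y_def)
  have steps: "(\<lambda>r. norm (y (Suc r) - y r)) \<longlonglongrightarrow> 0"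
    using D0 assms(13) dec by (rule steps_tendsto_0_if_sufficient_decrease)

  \<comment> \<open>The positive limit inferior gives a positive lower bound for all but finitely
    many stepsizes, hence for the factor \<open>1 / \<alpha> r\<close> an upper bound.\<close>
  obtain a where a: "a > 0" "\<forall>\<^sub>F r in sequentially. \<alpha> r > a"
  proof -
    have "liminf (\<lambda>r. ereal (\<alpha> r)) > 0" using assms(12) by (simp add: APS_sequence_def)
    then obtain a where "0 < ereal a" "ereal a < liminf (\<lambda>r. ereal (\<alpha> r))"
      using ereal_dense2 by blast
    then show ?thesis using less_LiminfD[of "ereal a" sequentially "\<lambda>r. ereal (\<alpha> r)"]
      by (intro that[of a]) simp_all
  qed
  define K where "K = 1 / a + L + \<kappa>"
  have "L \<ge> 0" using assms(8) by (rule lipschitz_on_nonneg)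
  then have "K > 0" using a(1) assms(11) by (simp add: K_def add_pos_nonneg)
  have w: "norm (v (Suc r) + g (y (Suc r))) \<le> K * norm (y (Suc r) - y r)" if "\<alpha> (Suc r) > a" for r
  proof -
    let ?d = "y r - y (Suc r)"
    \<comment> \<open>Since \<open>y r\<close> is \<open>x (Suc r)\<close>, this step uses the
      stepsize and error of index \<open>Suc r\<close>. The two gradients pair into a difference
      controlled by \<open>L\<close>.\<close>
    have eq: "v (Suc r) + g (y (Suc r)) = (1 / \<alpha> (Suc r)) *\<^sub>R ?d - (g (y r) - g (y (Suc r))) - e (Suc r)"
      by (simp add: v_def y_def)
    have "norm (v (Suc r) + g (y (Suc r)))
        \<le> norm ((1 / \<alpha> (Suc r)) *\<^sub>R ?d) + norm (g (y r) - g (y (Suc r))) + norm (e (Suc r))"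
      unfolding eq using norm_triangle_ineq4[of "(1 / \<alpha> (Suc r)) *\<^sub>R ?d" "g (y r) - g (y (Suc r))"]
        norm_triangle_ineq4[of "(1 / \<alpha> (Suc r)) *\<^sub>R ?d - (g (y r) - g (y (Suc r)))" "e (Suc r)"]
      by linarith
    also have "\<dots> \<le> (1 / a) * norm ?d + L * norm ?d + \<kappa> * norm ?d"
    proof (intro add_mono)
      show "norm ((1 / \<alpha> (Suc r)) *\<^sub>R ?d) \<le> (1 / a) * norm ?d"
        using that a(1) by (auto intro!: mult_right_mono simp: frac_le)
      show "norm (g (y r) - g (y (Suc r))) \<le> L * norm ?d"
        using lipschitz_onD[OF assms(8), of "y r" "y (Suc r)"] by (simp add: dist_norm)
      show "norm (e (Suc r)) \<le> \<kappa> * norm ?d" using e[of "Suc r"] by (simp add: y_def)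
    qed
    finally show ?thesis by (simp add: K_def algebra_simps norm_minus_commute)
  qed
  \<comment> \<open>The proximal centers \<open>y r + v r\<close> and \<open>y r - g (y r)\<close>
    differ by \<open>v r + g (y r)\<close>, and the first has proximal point
    \<open>y r\<close>.\<close>
  have residual: "prox_residual X f1 g (y r) \<le> norm (v r + g (y r))" for r
    using prox_vi_nonexpansive[OF vi[of r] prox_vi_prox[OF assms(4,2,3) y0, of "y r - g (y r)"]]
    by (simp add: prox_residual_def)

  \<comment> \<open>The level is the objective value at \<open>y 0\<close>; as the gaps decrease,
    every later iterate stays below it, so one pair \<open>\<delta>\<close>, \<open>\<tau>\<close>
    serves all of them.\<close>
  have "(INF x\<in>X. ?F x) \<le> ereal (D 0 + m)"
    unfolding Fy[of 0, symmetric] y_def by (rule INF_lower) (rule xX)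
  then obtain \<delta> \<tau> where eb: "\<delta> > 0" "\<tau> > 0"
    "\<And>x. x \<in> X \<Longrightarrow> ?F x \<le> ereal (D 0 + m) \<Longrightarrow> prox_residual X f1 g x \<le> \<delta> \<Longrightarrow>
       infdist x (closure ?S) \<le> \<tau> * prox_residual X f1 g x"
    using assms(10) unfolding local_error_bound_def by metis
  have "decseq D"
  proof -
    have "D (Suc r) \<le> D r" for r
    proof -
      have "0 \<le> c\<^sub>1 * (norm (y (Suc r) - y r))\<^sup>2" using assms(13) by simp
      then show ?thesis using dec[of r] by linarith
    qed
    then show ?thesis by (simp add: decseq_Suc_iff)
  qed
  have gap: "D (Suc r) \<le> \<tau> * K\<^sup>2 * (norm (y (Suc r) - y r))\<^sup>2"
    if r: "\<alpha> (Suc r) > a" "K * norm (y (Suc r) - y r) < \<delta>" for r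
  proof -
    let ?y = "y (Suc r)" and ?w = "norm (v (Suc r) + g (y (Suc r)))"
    have "prox_residual X f1 g ?y \<le> \<delta>" using residual[of "Suc r"] w[OF r(1)] r(2) by linarith
    moreover have "?F ?y \<le> ereal (D 0 + m)"
      using \<open>decseq D\<close> by (simp add: Fy decseqD)
    ultimately have "infdist ?y (closure ?S) \<le> \<tau> * prox_residual X f1 g ?y"
      using xX by (intro eb(3)) (simp_all add: y_def)
    also have "\<dots> \<le> \<tau> * ?w" using residual eb(2) by simp
    finally have inf: "infdist ?y ?S \<le> \<tau> * ?w"
      by (simp add: infdist_eq_setdist setdist_closure_2)
    \<comment> \<open>The gap bound holds against each solution, so after division by
      \<open>?w\<close> it passes to the infimum of the distances. If \<open>?w = 0\<close>, any one
      solution already shows the gap to be at most 0.\<close>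
    have "D (Suc r) \<le> ?w * infdist ?y ?S"
    proof (cases "?w = 0")
      case True
      then show ?thesis
        using objective_gap_le[OF vi assms(6,7) S_min(1)[OF s] m b, of "Suc r"] by (simp add: D_def)
    next
      case False
      then have "?w > 0" by simp
      have "D (Suc r) / ?w \<le> dist ?y s'" if "s' \<in> ?S" for s'
        using objective_gap_le[OF vi assms(6,7) S_min(1)[OF that] FS[OF that] b, of "Suc r"] \<open>?w > 0\<close>
        by (simp add: D_def field_simps)
      then have "D (Suc r) / ?w \<le> infdist ?y ?S"
        using assms(9) unfolding infdist_def by (auto intro: cINF_greatest)
      then show ?thesis using \<open>?w > 0\<close> by (simp add: field_simps)
    qed
    also have "\<dots> \<le> ?w * (\<tau> * ?w)" using inf by (intro mult_left_mono) auto
    also have "\<dots> = \<tau> * ?w\<^sup>2" by (simp add: power2_eq_square)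
    also have "\<dots> \<le> \<tau> * (K * norm (?y - y r))\<^sup>2"
      using w[OF r(1)] eb(2) by (intro mult_left_mono power_mono) auto
    finally show ?thesis by (simp add: power_mult_distrib)
  qed

  have "(\<lambda>r. K * norm (y (Suc r) - y r)) \<longlonglongrightarrow> K * 0" by (intro tendsto_mult_left steps)
  then have "\<forall>\<^sub>F r in sequentially. K * norm (y (Suc r) - y r) < \<delta>"
    using eb(1) by (auto dest: order_tendstoD(2))
  moreover have "\<forall>\<^sub>F r in sequentially. \<alpha> (Suc r) > a"
    using a(2) by (subst eventually_sequentially_Suc)
  ultimately have "\<forall>\<^sub>F r in sequentially. D (Suc r) \<le> \<tau> * K\<^sup>2 * (norm (y (Suc r) - y r))\<^sup>2"
    by eventually_elim (rule gap)
  then obtain N where N: "\<And>r. r \<ge> N \<Longrightarrow> D (Suc r) \<le> \<tau> * K\<^sup>2 * (norm (y (Suc r) - y r))\<^sup>2"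
    by (auto simp: eventually_sequentially)
  \<comment> \<open>The gap estimate holds only from \<open>N\<close> on, so the contraction
    argument runs on the tail, with \<open>\<tau> * K\<^sup>2\<close> as its constant.\<close>
  have "\<exists>z. R_linearly_converges (\<lambda>k. y (k + N)) z"
    using D0 dec N assms(13) eb(2) \<open>K > 0\<close>
    by (intro R_linearly_converges_if_gap_le_step[where D = "\<lambda>k. D (k + N)" and c = c\<^sub>1 and K = "\<tau> * K\<^sup>2"]) auto
  then obtain z where "R_linearly_converges (\<lambda>k. x (k + Suc N)) z" by (auto simp: y_def)
  then have z: "R_linearly_converges x z" by (rule R_linearly_converges_shift)
  then have lim: "y \<longlonglongrightarrow> z" unfolding y_def by (intro LIMSEQ_Suc R_linearly_converges_tendsto)
  \<comment> \<open>Squeezing the gaps between 0 and the vanishing squared steps shows that the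
    limit \<open>z\<close> is optimal.\<close>
  have "(\<lambda>r. \<tau> * K\<^sup>2 * (norm (y (Suc r) - y r))\<^sup>2) \<longlonglongrightarrow> \<tau> * K\<^sup>2 * 0\<^sup>2"
    by (intro tendsto_intros steps)
  then have "(\<lambda>r. D (Suc r)) \<longlonglongrightarrow> 0"
    using N D0 by (intro Lim_null_comparison[where f = "\<lambda>r. D (Suc r)"]) (auto simp: eventually_sequentially)
  then have "D \<longlonglongrightarrow> 0" by (rule LIMSEQ_imp_Suc)
  moreover have "isCont f2 z"
    using assms(7)[of z] unfolding gderiv_def by (rule has_derivative_continuous)
  ultimately have "z \<in> ?S"
    using xX lim b unfolding D_def
    by (intro limit_in_minimizers[OF assms(4,2) _ s m, of z y b]) (auto simp: y_def)
  then show ?thesis using z by blast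
qed

end
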